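(* (Ergodic Theorem) Let $(X,\mathcal B,\mu)$ be a probability space, let $T:X\to X$ be a (possibly noninvertible) measure-preserving transformation, and let $f\in L^1(X,\mathcal B,\mu)$ be real-valued. Then the sequence $(A_kf)_{k\ge1}$ of averages $$A_kf(x)=\frac1k\sum_{j=0}^{k-1} f(T^jx)$$ converges for $\mu$-a.e. $x\in X$.
   Context: $T$ measure-preserving means that $T$ is measurable and $\mu(T^{-1}B)=\mu(B)$ for all $B\in\mathcal B$. Convergence means convergence in $\mathbb R$ (to a finite limit). *)

theory Defs
  imports "HOL-Probability.Probability"
begin

definition measure_preserving :: "'a measure \<Rightarrow> ('a \<Rightarrow> 'a) \<Rightarrow> bool" where
  "measure_preserving M T \<longleftrightarrow>
     T \<in> M \<rightarrow>\<^sub>M M \<and> (\<forall>B\<in>sets M. emeasure M (T -` B \<inter> space M) = emeasure M B)"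

definition ergodic_average :: "('a \<Rightarrow> 'a) \<Rightarrow> ('a \<Rightarrow> real) \<Rightarrow> nat \<Rightarrow> 'a \<Rightarrow> real" where
  "ergodic_average T f k x = (1 / real k) * (\<Sum>j<k. f ((T ^^ j) x))"

end

(* Proof after Garsia. If A is invariant and every point of A has a positive
   Birkhoff sum of h, then the integral of h over A is nonnegative. The set where
   the Birkhoff sums of f - b are unbounded above is exactly invariant and contains
   every point where the upper limit of the averages exceeds b. Playing f - b
   against a - f for rationals a < b shows that the averages almost nowhere
   oscillate, and letting b tend to infinity shows that they are almost everywhere
   bounded. *)

theory Submission
  imports Defs
begin

section \<open>Birkhoff sums and their running maxima\<close>

definition birkhoff_sum :: "('a \<Rightarrow> 'a) \<Rightarrow> ('a \<Rightarrow> real) \<Rightarrow> nat \<Rightarrow> 'a \<Rightarrow> real" where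
  "birkhoff_sum T h n x = (\<Sum>j<n. h ((T ^^ j) x))"

text \<open>The largest of the Birkhoff sums of lengths 0 to \<open>n\<close>. The recursive form
  relates it at once to the maximum at \<open>T x\<close>, which is the comparison that Garsia's
  argument needs.\<close>

primrec birkhoff_max :: "('a \<Rightarrow> 'a) \<Rightarrow> ('a \<Rightarrow> real) \<Rightarrow> nat \<Rightarrow> 'a \<Rightarrow> real" where
  "birkhoff_max T h 0 x = 0"
| "birkhoff_max T h (Suc n) x = max 0 (h x + birkhoff_max T h n (T x))"

text \<open>Thresholds range over the naturals so that the set is built by countable operations and
  is visibly measurable.\<close>

definition unbounded_above :: "'a measure \<Rightarrow> ('a \<Rightarrow> 'a) \<Rightarrow> ('a \<Rightarrow> real) \<Rightarrow> 'a set" where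
  "unbounded_above M T h = {x \<in> space M. \<forall>K::nat. \<exists>n. real K < birkhoff_sum T h n x}"

text \<open>Invariance is demanded at every point of the space, not just up to null sets, so that
  the indicators of \<open>A\<close> at \<open>x\<close> and at \<open>T x\<close> agree
  pointwise.\<close>

definition invariant_set :: "'a measure \<Rightarrow> ('a \<Rightarrow> 'a) \<Rightarrow> 'a set \<Rightarrow> bool" where
  "invariant_set M T A \<longleftrightarrow> A \<in> sets M \<and> (\<forall>x\<in>space M. T x \<in> A \<longleftrightarrow> x \<in> A)"

lemma birkhoff_sum_0 [simp]: "birkhoff_sum T h 0 x = 0"
  by (simp add: birkhoff_sum_def)

lemma birkhoff_sum_Suc: "birkhoff_sum T h (Suc n) x = h x + birkhoff_sum T h n (T x)"
  unfolding birkhoff_sum_def sum.lessThan_Suc_shift by (simp add: funpow_swap1)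

lemma birkhoff_sum_diff_const:
  "birkhoff_sum T (\<lambda>x. f x - b) n x = birkhoff_sum T f n x - real n * b"
  by (simp add: birkhoff_sum_def sum_subtractf)

lemma birkhoff_sum_const_diff:
  "birkhoff_sum T (\<lambda>x. b - f x) n x = real n * b - birkhoff_sum T f n x"
  by (simp add: birkhoff_sum_def sum_subtractf)

lemma birkhoff_max_nonneg: "0 \<le> birkhoff_max T h n x"
  by (cases n) auto

lemma birkhoff_max_mono_Suc: "birkhoff_max T h n x \<le> birkhoff_max T h (Suc n) x"
proof (induction n arbitrary: x)
  case (Suc n)
  have "h x + birkhoff_max T h n (T x) \<le> h x + birkhoff_max T h (Suc n) (T x)"
    using Suc.IH[of "T x"] by simp
  then show ?case
    unfolding birkhoff_max.simps(2)[of T h "Suc n" x]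
    by (subst birkhoff_max.simps(2)) (rule max.mono, auto)
qed simp

lemma birkhoff_sum_le_max: "birkhoff_sum T h n x \<le> birkhoff_max T h n x"
proof (induction n arbitrary: x)
  case (Suc n)
  show ?case
    using Suc.IH[of "T x"] by (simp add: birkhoff_sum_Suc)
qed simp

text \<open>Garsia's inequality. A positive maximum means that the \<open>0\<close> in the recursion
  is not attained, so the value for \<open>Suc m\<close> is \<open>h x\<close> plus the maximum for
  \<open>m\<close> at \<open>T x\<close>; enlarging \<open>m\<close> to \<open>Suc m\<close> only
  increases the latter.\<close>

lemma birkhoff_max_le:
  assumes "0 < birkhoff_max T h n x"
  shows "birkhoff_max T h n x \<le> h x + birkhoff_max T h n (T x)"
proof (cases n)
  case (Suc m)
  then show ?thesis
    using assms birkhoff_max_mono_Suc[of T h m "T x"]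
    by (simp del: birkhoff_max.simps(2) add: birkhoff_max.simps(2)[of T h m x])
qed (use assms in simp)

section \<open>Invariance of integrals under the transformation\<close>

lemma measure_preserving_measurable: "measure_preserving M T \<Longrightarrow> T \<in> M \<rightarrow>\<^sub>M M"
  by (simp add: measure_preserving_def)

lemma measure_preserving_distr:
  assumes "measure_preserving M T"
  shows "distr M M T = M"
  by (rule measure_eqI) (use assms in \<open>auto simp: measure_preserving_def emeasure_distr\<close>)

lemma
  fixes u :: "'a \<Rightarrow> real"
  assumes T: "measure_preserving M T" and u: "integrable M u"
  shows measure_preserving_integrable: "integrable M (\<lambda>x. u (T x))"
    and measure_preserving_integral: "(\<integral>x. u (T x) \<partial>M) = (\<integral>x. u x \<partial>M)"
proof -
  note [measurable] = measure_preserving_measurable[OF T]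
  have [measurable]: "u \<in> borel_measurable M"
    using u by simp
  show "integrable M (\<lambda>x. u (T x))"
    using u integrable_distr_eq[of T M M u] by (simp add: measure_preserving_distr[OF T])
  show "(\<integral>x. u (T x) \<partial>M) = (\<integral>x. u x \<partial>M)"
    using integral_distr[of T M M u] by (simp add: measure_preserving_distr[OF T])
qed

section \<open>The maximal ergodic theorem\<close>

lemma integrable_birkhoff_max:
  assumes "measure_preserving M T" "integrable M h"
  shows "integrable M (birkhoff_max T h n)"
proof (induction n)
  case (Suc n)
  then show ?case
    using assms measure_preserving_integrable[OF assms(1) Suc] by simp
qed simp

text \<open>Garsia's inequality bounds \<open>h\<close> from below by
  \<open>?m n x - ?m n (T x)\<close> wherever \<open>?m n\<close> is positive, and over an invariant
  set this difference has integral zero. The restriction to \<open>0 < ?m n x\<close> is then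
  removed by letting \<open>n\<close> grow.\<close>

lemma maximal_ergodic:
  assumes T: "measure_preserving M T" and h: "integrable M h"
    and A: "invariant_set M T A"
    and pos: "\<And>x. x \<in> A \<Longrightarrow> \<exists>n. 0 < birkhoff_sum T h n x"
  shows "0 \<le> (\<integral>x. indicator A x * h x \<partial>M)"
proof -
  let ?m = "birkhoff_max T h"
  let ?g = "\<lambda>n x. indicator A x * (if 0 < ?m n x then h x else 0)"
  have A_sets [measurable]: "A \<in> sets M"
    using A by (simp add: invariant_set_def)
  note m_int = integrable_birkhoff_max[OF T h]
  have [measurable]: "h \<in> borel_measurable M" "?m n \<in> borel_measurable M" for n
    using h m_int by simp_all
  have Am_int: "integrable M (\<lambda>x. indicator A x * ?m n x)" for n
    using integrable_mult_indicator[OF A_sets m_int[of n]] by simp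
  have g_int: "integrable M (?g n)" for n
    by (rule Bochner_Integration.integrable_bound[OF h]) (auto split: split_indicator)
  have g_nonneg: "0 \<le> (\<integral>x. ?g n x \<partial>M)" for n
  proof -
    \<comment> \<open>Invariance of the integral is applied to the product
      \<open>indicator A x * ?m n x\<close>, so both factors are moved along
      \<open>T\<close>.\<close>
    have "0 = (\<integral>x. indicator A x * ?m n x \<partial>M) - (\<integral>x. indicator A (T x) * ?m n (T x) \<partial>M)"
      using measure_preserving_integral[OF T Am_int[of n]] by simp
    also have "\<dots> = (\<integral>x. indicator A x * ?m n x - indicator A (T x) * ?m n (T x) \<partial>M)"
      by (rule Bochner_Integration.integral_diff[symmetric])
        (use Am_int measure_preserving_integrable[OF T Am_int[of n]] in auto)
    also have "\<dots> \<le> (\<integral>x. ?g n x \<partial>M)"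
    proof (rule integral_mono)
      show "integrable M (\<lambda>x. indicator A x * ?m n x - indicator A (T x) * ?m n (T x))"
        using Am_int measure_preserving_integrable[OF T Am_int[of n]] by auto
      fix x assume "x \<in> space M"
      then have "indicator A (T x) = (indicator A x :: real)"
        using A by (auto simp: invariant_set_def indicator_def)
      \<comment> \<open>On \<open>A\<close>, where \<open>?m n x\<close> is positive this is
        Garsia's inequality; where it vanishes the left side is \<open>- ?m n (T x)\<close>, which
        is at most 0. Off \<open>A\<close> both sides are 0.\<close>
      then show "indicator A x * ?m n x - indicator A (T x) * ?m n (T x) \<le> ?g n x"
        using birkhoff_max_le[of T h n x] birkhoff_max_nonneg[of T h n x]
          birkhoff_max_nonneg[of T h n "T x"]
        by (auto simp: indicator_def)
    qed (rule g_int)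
    finally show ?thesis .
  qed
  \<comment> \<open>At a point of \<open>A\<close> a single positive sum of length \<open>N\<close>
    keeps \<open>?m n x\<close> positive for all n \<ge> N, so the truncated integrand is eventually
    \<open>h x\<close>; dominated convergence applies with bound
    \<open>\<bar>h x\<bar>\<close>.\<close>
  have "(\<lambda>n. \<integral>x. ?g n x \<partial>M) \<longlonglongrightarrow> (\<integral>x. indicator A x * h x \<partial>M)"
  proof (rule integral_dominated_convergence[where w = "\<lambda>x. \<bar>h x\<bar>"])
    show "AE x in M. (\<lambda>n. ?g n x) \<longlonglongrightarrow> indicator A x * h x"
    proof (rule AE_I2)
      fix x
      show "(\<lambda>n. ?g n x) \<longlonglongrightarrow> indicator A x * h x"
      proof (cases "x \<in> A")
        case True
        obtain N where N: "0 < birkhoff_sum T h N x"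
          using pos[OF True] by blast
        have "0 < ?m n x" if "N \<le> n" for n
          using N birkhoff_sum_le_max[of T h N x]
            lift_Suc_mono_le[of "\<lambda>n. ?m n x", OF birkhoff_max_mono_Suc that]
          by linarith
        then have "eventually (\<lambda>n. ?g n x = indicator A x * h x) sequentially"
          unfolding eventually_sequentially by (metis (full_types))
        then show ?thesis
          by (rule tendsto_eventually)
      qed simp
    qed
    show "AE x in M. norm (?g n x) \<le> \<bar>h x\<bar>" for n
      by (auto split: split_indicator)
  qed (use h in auto)
  then show ?thesis
    by (rule LIMSEQ_le_const) (use g_nonneg in blast)
qed

section \<open>Invariance of the sets of unbounded sums\<close>

lemma invariant_set_Int:
  "invariant_set M T A \<Longrightarrow> invariant_set M T B \<Longrightarrow> invariant_set M T (A \<inter> B)"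
  by (auto simp: invariant_set_def)

lemma invariant_set_INT:
  fixes A :: "nat \<Rightarrow> 'a set"
  shows "(\<And>k. invariant_set M T (A k)) \<Longrightarrow> invariant_set M T (\<Inter>k. A k)"
  by (auto simp: invariant_set_def)

text \<open>The sum of length \<open>Suc n\<close> at \<open>x\<close> and that of length
  \<open>n\<close> at \<open>T x\<close> differ by \<open>h x\<close>, which does not depend on
  \<open>n\<close>; shifting the threshold by this amount transfers unboundedness both ways.\<close>

lemma invariant_unbounded_above:
  assumes T [measurable]: "T \<in> M \<rightarrow>\<^sub>M M" and h [measurable]: "h \<in> borel_measurable M"
  shows "invariant_set M T (unbounded_above M T h)"
  unfolding invariant_set_def
proof (intro conjI ballI)
  have [measurable]: "birkhoff_sum T h n \<in> borel_measurable M" for n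
    unfolding birkhoff_sum_def by measurable
  show "unbounded_above M T h \<in> sets M"
    unfolding unbounded_above_def by measurable
  fix x assume x: "x \<in> space M"
  then have Tx: "T x \<in> space M"
    using T by (rule measurable_space[rotated])
  have fwd: "\<exists>n. real K < birkhoff_sum T h n x"
    if unb: "\<forall>K::nat. \<exists>n. real K < birkhoff_sum T h n (T x)" for K :: nat
  proof -
    obtain K' :: nat where "real K - h x < real K'"
      using reals_Archimedean2 by blast
    moreover obtain n where "real K' < birkhoff_sum T h n (T x)"
      using unb by blast
    ultimately have "real K < birkhoff_sum T h (Suc n) x"
      by (simp add: birkhoff_sum_Suc)
    then show ?thesis ..
  qed
  have bwd: "\<exists>n. real K < birkhoff_sum T h n (T x)"
    if unb: "\<forall>K::nat. \<exists>n. real K < birkhoff_sum T h n x" for K :: nat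
  proof -
    obtain K' :: nat where K': "real K + h x < real K'"
      using reals_Archimedean2 by blast
    obtain n where n: "real K' < birkhoff_sum T h n x"
      using unb by blast
    \<comment> \<open>The empty sum is 0 and cannot exceed the nonnegative \<open>real K'\<close>,
      so there is a first term to split off.\<close>
    then obtain m where "n = Suc m"
      by (cases n) auto
    then have "real K < birkhoff_sum T h m (T x)"
      using K' n by (simp add: birkhoff_sum_Suc)
    then show ?thesis ..
  qed
  show "T x \<in> unbounded_above M T h \<longleftrightarrow> x \<in> unbounded_above M T h"
    using x Tx fwd bwd unfolding unbounded_above_def by blast
qed

lemma integral_nonneg_if_unbounded_above:
  assumes "measure_preserving M T" "integrable M h" "invariant_set M T A"
    and sub: "A \<subseteq> unbounded_above M T h"
  shows "0 \<le> (\<integral>x. indicator A x * h x \<partial>M)"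
proof (rule maximal_ergodic[OF assms(1-3)])
  fix x assume "x \<in> A"
  with sub have "\<exists>n. real 0 < birkhoff_sum T h n x"
    unfolding unbounded_above_def by blast
  then show "\<exists>n. 0 < birkhoff_sum T h n x"
    by simp
qed

section \<open>Null sets of oscillation and of unbounded averages\<close>

lemma (in finite_measure) integral_indicator_diff_const:
  fixes f :: "'a \<Rightarrow> real"
  assumes "A \<in> sets M" "integrable M f"
  shows "(\<integral>x. indicator A x * (f x - b) \<partial>M) = (\<integral>x. indicator A x * f x \<partial>M) - b * measure M A"
    and "(\<integral>x. indicator A x * (b - f x) \<partial>M) = b * measure M A - (\<integral>x. indicator A x * f x \<partial>M)"
proof -
  have "integrable M (\<lambda>x. indicator A x * f x)"
    using integrable_mult_indicator[OF assms] by simp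
  moreover have "integrable M (\<lambda>x. indicator A x * b)"
    using assms by (intro integrable_mult_left integrable_real_indicator)
      (auto simp: emeasure_finite less_top[symmetric])
  ultimately show "(\<integral>x. indicator A x * (f x - b) \<partial>M) = (\<integral>x. indicator A x * f x \<partial>M) - b * measure M A"
    and "(\<integral>x. indicator A x * (b - f x) \<partial>M) = b * measure M A - (\<integral>x. indicator A x * f x \<partial>M)"
    using assms by (simp_all add: right_diff_distrib)
qed

lemma (in finite_measure) AE_not_oscillating:
  fixes f :: "'a \<Rightarrow> real"
  assumes T: "measure_preserving M T" and f: "integrable M f" and "a < b"
  shows "AE x in M. x \<notin> unbounded_above M T (\<lambda>x. f x - b) \<inter> unbounded_above M T (\<lambda>x. a - f x)"
proof -
  let ?A = "unbounded_above M T (\<lambda>x. f x - b) \<inter> unbounded_above M T (\<lambda>x. a - f x)"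
  have inv: "invariant_set M T ?A"
    using f measure_preserving_measurable[OF T]
    by (intro invariant_set_Int invariant_unbounded_above) auto
  then have A: "?A \<in> sets M"
    by (simp add: invariant_set_def)
  have "0 \<le> (\<integral>x. indicator ?A x * (f x - b) \<partial>M)" "0 \<le> (\<integral>x. indicator ?A x * (a - f x) \<partial>M)"
    using f by (intro integral_nonneg_if_unbounded_above[OF T _ inv]; auto)+
  \<comment> \<open>The two inequalities say that the integral of \<open>f\<close> over
    \<open>?A\<close> is at least \<open>b * measure M ?A\<close> and at most
    \<open>a * measure M ?A\<close>; adding them cancels that integral.\<close>
  then have "0 \<le> (a - b) * measure M ?A"
    unfolding integral_indicator_diff_const[OF A f] by (simp add: left_diff_distrib)
  then have "measure M ?A = 0"
    using \<open>a < b\<close> measure_nonneg[of M ?A] by (simp add: zero_le_mult_iff)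
  then have "?A \<in> null_sets M"
    using A by (simp add: null_sets_def emeasure_eq_measure)
  then show ?thesis
    by (rule AE_not_in)
qed

text \<open>On the exceptional set the maximal inequality holds for every \<open>k\<close> at once,
  so a fixed finite integral of \<open>f\<close> dominates all multiples of its measure. Used for
  \<open>f\<close> and for its negative, this bounds the averages on both sides.\<close>

lemma (in finite_measure) AE_not_unbounded_above:
  fixes f :: "'a \<Rightarrow> real"
  assumes T: "measure_preserving M T" and f: "integrable M f"
  shows "AE x in M. \<exists>k::nat. x \<notin> unbounded_above M T (\<lambda>x. f x - real k)"
proof -
  let ?A = "\<Inter>k::nat. unbounded_above M T (\<lambda>x. f x - real k)"
  have inv: "invariant_set M T ?A"
    using f measure_preserving_measurable[OF T]
    by (intro invariant_set_INT invariant_unbounded_above) auto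
  then have A: "?A \<in> sets M"
    by (simp add: invariant_set_def)
  have bound: "real k * measure M ?A \<le> (\<integral>x. indicator ?A x * f x \<partial>M)" for k
  proof -
    have "0 \<le> (\<integral>x. indicator ?A x * (f x - real k) \<partial>M)"
      using f by (intro integral_nonneg_if_unbounded_above[OF T _ inv]) auto
    then show ?thesis
      unfolding integral_indicator_diff_const[OF A f] by simp
  qed
  have "measure M ?A = 0"
  proof (rule ccontr)
    assume "measure M ?A \<noteq> 0"
    then have "0 < measure M ?A"
      using measure_nonneg[of M ?A] by linarith
    then show False
      using ex_less_of_nat_mult[of "measure M ?A" "\<integral>x. indicator ?A x * f x \<partial>M"] bound
      by (meson not_less)
  qed
  then have "?A \<in> null_sets M"
    using A by (simp add: null_sets_def emeasure_eq_measure)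
  then have "AE x in M. x \<notin> ?A"
    by (rule AE_not_in)
  then show ?thesis
    by simp
qed

section \<open>A convergence criterion for averages of a real sequence\<close>

lemma frequently_gt_imp_unbounded:
  fixes s :: "nat \<Rightarrow> real"
  assumes "b < c" and freq: "\<exists>\<^sub>F n in sequentially. c < s (Suc n) / real (Suc n)"
  shows "\<exists>n. real K < s n - real n * b"
proof -
  \<comment> \<open>An average above \<open>c\<close> over \<open>m\<close> terms gives an excess
    over \<open>m * b\<close> of more than \<open>m * (c - b)\<close>, so \<open>N\<close> is the
    length from which this passes \<open>K\<close>.\<close>
  obtain N :: nat where N: "real K < real N * (c - b)"
    using ex_less_of_nat_mult[of "c - b" "real K"] \<open>b < c\<close> by auto
  obtain n where n: "N \<le> n" "c < s (Suc n) / real (Suc n)"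
    using freq unfolding frequently_sequentially by blast
  have "real N * (c - b) \<le> real (Suc n) * (c - b)"
    using n(1) \<open>b < c\<close> by (intro mult_right_mono) auto
  moreover have "real (Suc n) * c < s (Suc n)"
    using n(2) by (simp add: field_simps)
  ultimately have "real K < s (Suc n) - real (Suc n) * b"
    using N by (simp add: algebra_simps)
  then show ?thesis ..
qed

lemma average_le_if_bounded:
  fixes s :: "nat \<Rightarrow> real"
  assumes "s (Suc n) - real (Suc n) * b \<le> real K"
  shows "s (Suc n) / real (Suc n) \<le> b + real K"
proof -
  \<comment> \<open>The bound \<open>K\<close> on the sums serves for the averages too because the
    divisor is at least 1; the slack is \<open>real K * real n\<close>.\<close>
  have "(b + real K) * real (Suc n) = real K + real (Suc n) * b + real K * real n"
    by (simp add: algebra_simps)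
  moreover have "0 \<le> real K * real n"
    by simp
  ultimately have "s (Suc n) \<le> (b + real K) * real (Suc n)"
    using assms by linarith
  then show ?thesis
    by (subst pos_divide_le_eq) auto
qed

text \<open>Pointwise part of the proof. The first two hypotheses make the upper and lower limits
  finite, the third makes them equal; asking it only for rationals leaves countably many null sets
  to discard.\<close>

lemma convergent_average:
  fixes s :: "nat \<Rightarrow> real"
  assumes above: "\<exists>b K. \<forall>n. s n - real n * b \<le> real K"
    and below: "\<exists>b K. \<forall>n. - s n - real n * b \<le> real K"
    and osc: "\<And>a b. a \<in> \<rat> \<Longrightarrow> b \<in> \<rat> \<Longrightarrow> a < b \<Longrightarrow>
      \<not> ((\<forall>K::nat. \<exists>n. real K < s n - real n * b) \<and> (\<forall>K::nat. \<exists>n. real K < real n * a - s n))"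
  shows "convergent (\<lambda>n. s (Suc n) / real (Suc n))"
proof -
  let ?a = "\<lambda>n. s (Suc n) / real (Suc n)"
  let ?L = "liminf (\<lambda>n. ereal (?a n))" and ?U = "limsup (\<lambda>n. ereal (?a n))"
  obtain B where B: "?a n \<le> B" for n
    using above average_le_if_bounded[of s] by blast
  obtain C where C: "- ?a n \<le> C" for n
    using below average_le_if_bounded[of "\<lambda>n. - s n"] by (metis minus_divide_left)
  have UB: "?U \<le> ereal B"
    by (rule Limsup_bounded) (use B in auto)
  have LC: "ereal (- C) \<le> ?L"
    by (rule Liminf_bounded) (use C in \<open>auto simp: minus_le_iff\<close>)
  have LU: "?L \<le> ?U"
    by (rule Liminf_le_Limsup) simp
  have "?L = ?U"
  proof (rule ccontr)
    assume "?L \<noteq> ?U"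
    with LU have "?L < ?U"
      by simp
    \<comment> \<open>The levels are chosen with \<open>p < a < b < q\<close>: \<open>a\<close> and
      \<open>b\<close> are rational as \<open>osc\<close> requires, and the outer gaps
      \<open>p < a\<close> and \<open>b < q\<close> provide the linear growth that makes the sums
      unbounded.\<close>
    then obtain p where p: "?L < ereal p" "ereal p < ?U"
      using ereal_dense2 by blast
    then obtain q where q: "ereal p < ereal q" "ereal q < ?U"
      using ereal_dense2 by blast
    obtain a where a: "a \<in> \<rat>" "p < a" "a < q"
      using Rats_dense_in_real[of p q] q by auto
    obtain b where b: "b \<in> \<rat>" "a < b" "b < q"
      using Rats_dense_in_real[of a q] a by auto
    have "\<exists>\<^sub>F n in sequentially. q < ?a n"
    proof (rule ccontr)
      assume "\<not> (\<exists>\<^sub>F n in sequentially. q < ?a n)"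
      then have "\<forall>\<^sub>F n in sequentially. ereal (?a n) \<le> ereal q"
        by (simp add: not_frequently not_less)
      then have "?U \<le> ereal q"
        by (rule Limsup_bounded)
      with q show False
        by simp
    qed
    then have up: "\<exists>n. real K < s n - real n * b" for K
      using frequently_gt_imp_unbounded[of b q s] b by blast
    have "\<exists>\<^sub>F n in sequentially. ?a n < p"
    proof (rule ccontr)
      assume "\<not> (\<exists>\<^sub>F n in sequentially. ?a n < p)"
      then have "\<forall>\<^sub>F n in sequentially. ereal p \<le> ereal (?a n)"
        by (simp add: not_frequently not_less)
      then have "ereal p \<le> ?L"
        by (rule Liminf_bounded)
      with p show False
        by simp
    qed
    \<comment> \<open>The lower side is the upper side for the sequence \<open>- s\<close>, with
      levels \<open>- a < - p\<close>.\<close>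
    then have "\<exists>\<^sub>F n in sequentially. - p < - s (Suc n) / real (Suc n)"
      by simp
    then have "\<exists>n. real K < - s n - real n * (- a)" for K
      using frequently_gt_imp_unbounded[of "- a" "- p" "\<lambda>n. - s n"] a by auto
    then have down: "\<exists>n. real K < real n * a - s n" for K
      by simp
    show False
      using osc[OF a(1) b(1,2)] up down by blast
  qed
  moreover obtain l where "?U = ereal l"
    using UB LC LU by (cases ?U) auto
  ultimately have "(\<lambda>n. ereal (?a n)) \<longlonglongrightarrow> ereal l"
    by (intro Liminf_eq_Limsup) auto
  then show ?thesis
    by (auto simp: convergent_def)
qed

theorem mainTheorem2:
  fixes M :: "'a measure" and T :: "'a \<Rightarrow> 'a" and f :: "'a \<Rightarrow> real"
  assumes "prob_space M"
    and "measure_preserving M T"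
    and "integrable M f"
  shows "AE x in M. convergent (\<lambda>k. ergodic_average T f (Suc k) x)"
proof -
  interpret prob_space M by fact
  have minus: "birkhoff_sum T (\<lambda>x. - f x) n x = - birkhoff_sum T f n x" for n x
    by (simp add: birkhoff_sum_def sum_negf)
  have "AE x in M. \<exists>k::nat. x \<notin> unbounded_above M T (\<lambda>x. f x - real k)"
    by (rule AE_not_unbounded_above[OF assms(2,3)])
  moreover have "AE x in M. \<exists>k::nat. x \<notin> unbounded_above M T (\<lambda>x. - f x - real k)"
    using assms(3) by (intro AE_not_unbounded_above[OF assms(2)]) simp
  moreover have "AE x in M. \<forall>a\<in>\<rat>. \<forall>b\<in>\<rat>. a < b \<longrightarrow>
      x \<notin> unbounded_above M T (\<lambda>x. f x - b) \<inter> unbounded_above M T (\<lambda>x. a - f x)"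
  proof -
    have "AE x in M. a < b \<longrightarrow>
        x \<notin> unbounded_above M T (\<lambda>x. f x - b) \<inter> unbounded_above M T (\<lambda>x. a - f x)" for a b :: real
      using AE_not_oscillating[OF assms(2,3), of a b] by (cases "a < b") auto
    then show ?thesis
      by (simp add: AE_ball_countable countable_rat)
  qed
  ultimately show ?thesis
    \<comment> \<open>Membership in \<open>unbounded_above\<close> includes lying in the space, so
      nonmembership yields a bound on the sums only at points of the space.\<close>
    using AE_space
  proof eventually_elim
    case (elim x)
    have "convergent (\<lambda>n. birkhoff_sum T f (Suc n) x / real (Suc n))"
    proof (rule convergent_average)
      show "\<exists>b K. \<forall>n. birkhoff_sum T f n x - real n * b \<le> real K"
        using elim(1,4) unfolding unbounded_above_def birkhoff_sum_diff_const
        by (auto simp: not_less)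
      show "\<exists>b K. \<forall>n. - birkhoff_sum T f n x - real n * b \<le> real K"
        using elim(2,4) unfolding unbounded_above_def birkhoff_sum_diff_const minus
        by (auto simp: not_less)
      fix a b :: real
      assume "a \<in> \<rat>" "b \<in> \<rat>" "a < b"
      with elim(3) have "x \<notin> unbounded_above M T (\<lambda>x. f x - b) \<inter> unbounded_above M T (\<lambda>x. a - f x)"
        by blast
      with elim(4) show "\<not> ((\<forall>K::nat. \<exists>n. real K < birkhoff_sum T f n x - real n * b) \<and>
          (\<forall>K::nat. \<exists>n. real K < real n * a - birkhoff_sum T f n x))"
        unfolding unbounded_above_def birkhoff_sum_diff_const birkhoff_sum_const_diff by blast
    qed
    then show ?case
      by (simp add: ergodic_average_def birkhoff_sum_def)
  qed
qed

end
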